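(* Let $D$ be a (nonempty) finite set of positive integers and let $\ell\ge\|D\|$ be an integer. Let $w=w^{(0)}\in\{0,1\}^{\mathbb{N}}$ be a $D$-avoiding string and let $w^{(1)},w^{(2)},\ldots$ be a sequence of elements of $\{0,1\}^{\mathbb{N}}$ for which $$w^{(0)}\vdash_\ell w^{(1)}\vdash_\ell w^{(2)}\vdash_\ell\cdots.$$ Then this sequence converges in the sense that there is a string $w^*\in\{0,1\}^{\mathbb{N}}$ such that for every position $t$, $w^*_t=w^{(k)}_t$ for all sufficiently large $k$.
   Context: $\mathbb{N}=\{0,1,2,\dots\}$, and $\|D\|$ denotes the largest element of $D$. For $S\subseteq\mathbb{N}$ put $S_q=\sum_{n\in S}q^n$ for $q\in(0,1)$. For $S,S'\subseteq\mathbb{N}$ write $S'\preceq S$ (the germ order) iff there exists $\epsilon>0$ such that $S'_q\le S_q$ for all $q\in(1-\epsilon,1)$; this is a partial order, total on finite sets. Finite or infinite bit strings $b_0b_1b_2\cdots$ are identified with the sets $\{n:b_n=1\}$, so the germ order applies to bit strings. A set (or bit string) is $D$-avoiding if no two elements of the set differ by an element of $D$. Juxtaposition denotes concatenation. For $\ell\ge\|D\|$ and $D$-avoiding strings $A,B\in\{0,1\}^{\|D\|}$, let $\Gamma_\ell(A,B)$ denote the unique string $G\in\{0,1\}^\ell$ such that $AGB$ is $D$-avoiding and $AZB\preceq AGB$ for all $Z\in\{0,1\}^\ell$ such that $AZB$ is $D$-avoiding. For $w,w'\in\{0,1\}^{\mathbb{N}}$ and such $A,B$, write $w\vdash_\ell^{A,B}w'$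 if $w$ can be written as $w=XAYBZ$ with $X$ a finite (possibly empty) string, $Y\in\{0,1\}^\ell$ and $Z$ an infinite string, so that $w'=XAGBZ$ where $G=\Gamma_\ell(A,B)$. Write $w\vdash_\ell w'$ if $w\vdash_\ell^{A,B}w'$ for some pair $A,B\in\{0,1\}^{\|D\|}$. *)

theory Defs
  imports "HOL-Analysis.Analysis" "HOL-Library.Stream"
begin

text \<open>Finite bit strings are of type \<^typ>\<open>bool list\<close>, infinite ones of type \<^typ>\<open>bool stream\<close>;
  both are indexed from 0.\<close>

definition ones :: "bool list \<Rightarrow> nat set" where
  "ones b = {n. n < length b \<and> b ! n}"

definition sones :: "bool stream \<Rightarrow> nat set" where
  "sones w = {n. w !! n}"

definition gen_sum :: "nat set \<Rightarrow> real \<Rightarrow> real" where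
  "gen_sum S q = (\<Sum>\<^sub>\<infinity>n\<in>S. q ^ n)"

definition germ_le :: "nat set \<Rightarrow> nat set \<Rightarrow> bool" (infix "\<preceq>" 50) where
  "S' \<preceq> S \<longleftrightarrow>
    (\<exists>\<epsilon>>0. \<forall>q. 0 < q \<and> 1 - \<epsilon> < q \<and> q < 1 \<longrightarrow> gen_sum S' q \<le> gen_sum S q)"

definition avoiding :: "nat set \<Rightarrow> nat set \<Rightarrow> bool" where
  "avoiding D S \<longleftrightarrow> (\<forall>x\<in>S. \<forall>y\<in>S. x < y \<longrightarrow> y - x \<notin> D)"

text \<open>The description below is only meaningful if \<open>D\<close> is a nonempty finite set of positive integers,
  \<open>Max D \<le> l\<close>, and \<open>A\<close>, \<open>B\<close> are \<open>D\<close>-avoiding of length \<open>Max D\<close>.  In that case the all-zero filling is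
  admissible, and since the germ order is a linear order on finite sets, a greatest filling exists
  and is unique.\<close>

definition Gam :: "nat set \<Rightarrow> nat \<Rightarrow> bool list \<Rightarrow> bool list \<Rightarrow> bool list" where
  "Gam D l A B =
    (THE G. length G = l \<and> avoiding D (ones (A @ G @ B)) \<and>
       (\<forall>Z. length Z = l \<and> avoiding D (ones (A @ Z @ B)) \<longrightarrow>
            ones (A @ Z @ B) \<preceq> ones (A @ G @ B)))"

definition step_at ::
  "nat set \<Rightarrow> nat \<Rightarrow> bool list \<Rightarrow> bool list \<Rightarrow> bool stream \<Rightarrow> bool stream \<Rightarrow> bool" where
  "step_at D l A B w w' \<longleftrightarrow>
    length A = Max D \<and> length B = Max D \<and> avoiding D (ones A) \<and> avoiding D (ones B) \<and>
    (\<exists>X Y Z. length Y = l \<and>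
       w = X @- A @- Y @- B @- Z \<and>
       w' = X @- A @- Gam D l A B @- B @- Z)"

definition step :: "nat set \<Rightarrow> nat \<Rightarrow> bool stream \<Rightarrow> bool stream \<Rightarrow> bool" where
  "step D l w w' \<longleftrightarrow> (\<exists>A B. step_at D l A B w w')"

end

theory Submission
  imports Defs
begin

text \<open>
  The idea is to evaluate the generating functions at one well-chosen number \<open>q < 1\<close> and to use
  the value \<open>gen_sum (sones w) q\<close> as a potential.

  A nonzero polynomial has a constant strict sign on some interval \<open>(1 - \<epsilon>, 1)\<close>.  Only finitely
  many sets can occur as a window \<open>A Y B\<close>, so a single \<open>q\<close> close enough to \<open>1\<close> decides
  the germ order on all of them: there, \<open>\<preceq>\<close> is just comparison of the values at \<open>q\<close>, and
  different sets have different values (\<open>germ_le_decided_at_point\<close>).  Hence the optimal filling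
  exists, and replacing \<open>Y\<close> by a different optimal filling raises the value of the window by at
  least a constant \<open>c > 0\<close>, the smallest gap between the finitely many values.

  If the window starts at position \<open>m\<close>, the value of the whole string rises by at least
  \<open>c * q ^ m\<close>; so a step that alters position \<open>t\<close> raises the potential by at least
  \<open>c * q ^ t\<close>, and no step lowers it (\<open>step_raises_value\<close>).  The potential is
  bounded by \<open>1 / (1 - q)\<close>, so it converges and its increments tend to \<open>0\<close>.  Thus, for each
  \<open>t\<close>, only finitely many steps alter position \<open>t\<close>.
\<close>

section \<open>Generating functions near 1\<close>

lemma summable_on_powers:
  fixes q :: real
  assumes "0 < q" "q < 1"
  shows "(\<lambda>n. q ^ n) summable_on S"
proof -
  have "(\<lambda>n. q ^ n) summable_on UNIV"
    using assms by (simp add: summable_on_UNIV_nonneg_real_iff summable_geometric)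
  then show ?thesis
    using summable_on_subset_banach by blast
qed

lemma gen_sum_le_geometric:
  assumes "0 < q" "q < 1"
  shows "gen_sum S q \<le> 1 / (1 - q)"
proof -
  have "gen_sum S q \<le> gen_sum UNIV q"
    unfolding gen_sum_def
    using assms by (intro infsum_mono_neutral summable_on_powers) auto
  also have "gen_sum UNIV q = (\<Sum>n. q ^ n)"
    unfolding gen_sum_def
    using has_sum_imp_sums[OF has_sum_infsum[OF summable_on_powers[OF assms, of UNIV]]]
    by (simp add: sums_iff)
  also have "\<dots> = 1 / (1 - q)"
    using assms by (simp add: suminf_geometric)
  finally show ?thesis .
qed

lemma gen_sum_concat:
  assumes q: "0 < q" "q < 1" and S: "S \<subseteq> {..<k}"
  shows "gen_sum (S \<union> (+) k ` T) q = gen_sum S q + q ^ k * gen_sum T q"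
proof -
  have "gen_sum (S \<union> (+) k ` T) q = gen_sum S q + gen_sum ((+) k ` T) q"
    unfolding gen_sum_def using q S by (intro infsum_Un_disjoint summable_on_powers) auto
  also have "gen_sum ((+) k ` T) q = (\<Sum>\<^sub>\<infinity>n\<in>T. q ^ k * q ^ n)"
    unfolding gen_sum_def by (subst infsum_reindex) (auto simp: o_def power_add)
  also have "\<dots> = q ^ k * gen_sum T q"
    unfolding gen_sum_def by (rule infsum_cmult_right')
  finally show ?thesis .
qed

text \<open>Factor out the zero at \<open>1\<close>: what remains keeps the sign of its value there, and the
  power of \<open>x - 1\<close> has a fixed sign to the left of \<open>1\<close>.\<close>

lemma poly_sign_at_left_1:
  fixes p :: "real poly"
  assumes "p \<noteq> 0"
  shows "(\<forall>\<^sub>F x in at_left 1. poly p x > 0) \<or> (\<forall>\<^sub>F x in at_left 1. poly p x < 0)"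
proof -
  obtain r where r: "p = [:-1, 1:] ^ order 1 p * r" "\<not> [:-1, 1:] dvd r"
    using order_decomp[OF assms, of 1] by auto
  define k where "k = order 1 p"
  have p: "poly p x = (-1) ^ k * ((1 - x) ^ k * poly r x)" for x
  proof -
    have "poly p x = (x - 1) ^ k * poly r x"
      by (subst r(1)) (simp add: k_def poly_power)
    also have "(x - 1) ^ k = (-1) ^ k * (1 - x) ^ k"
      by (simp flip: power_mult_distrib)
    finally show ?thesis by simp
  qed
  have "poly r 1 \<noteq> 0"
    using r(2) by (simp add: poly_eq_0_iff_dvd)
  have lim: "(poly r \<longlongrightarrow> poly r 1) (at_left 1)"
    using poly_isCont[of 1 r] by (simp add: isCont_def filterlim_at_split)
  have left: "\<forall>\<^sub>F x in at_left (1::real). x < 1"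
    by (simp add: eventually_at_filter)
  have "(\<forall>\<^sub>F x in at_left 1. poly r x > 0) \<or> (\<forall>\<^sub>F x in at_left 1. poly r x < 0)"
    using order_tendstoD[OF lim] \<open>poly r 1 \<noteq> 0\<close> by (meson linorder_neqE)
  then have *: "(\<forall>\<^sub>F x in at_left 1. (1 - x) ^ k * poly r x > 0)
      \<or> (\<forall>\<^sub>F x in at_left 1. (1 - x) ^ k * poly r x < 0)"
  proof (elim disj_forward)
    assume "\<forall>\<^sub>F x in at_left 1. poly r x > 0"
    then show "\<forall>\<^sub>F x in at_left 1. (1 - x) ^ k * poly r x > 0"
      using left by eventually_elim simp
  next
    assume "\<forall>\<^sub>F x in at_left 1. poly r x < 0"
    then show "\<forall>\<^sub>F x in at_left 1. (1 - x) ^ k * poly r x < 0"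
      using left by eventually_elim (simp add: mult_pos_neg)
  qed
  show ?thesis
  proof (cases "even k")
    case True
    then show ?thesis using * by (simp add: p)
  next
    case False
    then show ?thesis using * by (auto simp add: p)
  qed
qed

lemma germ_trichotomy:
  assumes "finite S" "finite T" "S \<noteq> T"
  shows "(\<forall>\<^sub>F q in at_left 1. gen_sum S q < gen_sum T q) \<or>
    (\<forall>\<^sub>F q in at_left 1. gen_sum T q < gen_sum S q)"
proof -
  define p :: "nat set \<Rightarrow> real poly" where "p U = (\<Sum>n\<in>U. monom 1 n)" for U
  have val: "poly (p U) q = gen_sum U q" if "finite U" for U q
    using that by (simp add: p_def gen_sum_def poly_sum poly_monom)
  have coeff: "coeff (p U) n = of_bool (n \<in> U)" if "finite U" for U n
    using that by (simp add: p_def coeff_sum)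
  have "p T - p S \<noteq> 0"
  proof
    assume "p T - p S = 0"
    then have "coeff (p T) n = coeff (p S) n" for n by simp
    then have "n \<in> T \<longleftrightarrow> n \<in> S" for n
      using assms by (metis coeff of_bool_eq_iff)
    then show False using assms by auto
  qed
  from poly_sign_at_left_1[OF this] show ?thesis
    using assms by (simp add: val)
qed

lemma germ_le_iff_eventually:
  "S \<preceq> T \<longleftrightarrow> (\<forall>\<^sub>F q in at_left 1. gen_sum S q \<le> gen_sum T q)"
proof
  assume "S \<preceq> T"
  then obtain e where e: "e > 0"
    "\<And>q. 0 < q \<Longrightarrow> 1 - e < q \<Longrightarrow> q < 1 \<Longrightarrow> gen_sum S q \<le> gen_sum T q"
    unfolding germ_le_def by blast
  have "\<forall>\<^sub>F q in at_left 1. q \<in> {max 0 (1 - e)<..<1}"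
    using e(1) by (intro eventually_at_leftI[of "max 0 (1 - e)"]) auto
  then show "\<forall>\<^sub>F q in at_left 1. gen_sum S q \<le> gen_sum T q"
    by eventually_elim (use e(2) in auto)
next
  assume "\<forall>\<^sub>F q in at_left 1. gen_sum S q \<le> gen_sum T q"
  then obtain b where b: "b < 1" "\<And>q. b < q \<Longrightarrow> q < 1 \<Longrightarrow> gen_sum S q \<le> gen_sum T q"
    unfolding eventually_at_left_field by blast
  show "S \<preceq> T"
    unfolding germ_le_def by (rule exI[of _ "1 - b"]) (use b in auto)
qed

text \<open>A finite family of finite sets involves only finitely many differences of generating
  functions, so all their signs have stabilised at some common \<open>q < 1\<close>.\<close>

lemma germ_le_decided_at_point:
  obtains q where "0 < q" "q < 1"
    "\<And>S T. S \<subseteq> {..<N} \<Longrightarrow> T \<subseteq> {..<N} \<Longrightarrow> S \<preceq> T \<longleftrightarrow> gen_sum S q \<le> gen_sum T q"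
    "\<And>S T. S \<subseteq> {..<N} \<Longrightarrow> T \<subseteq> {..<N} \<Longrightarrow> gen_sum S q = gen_sum T q \<Longrightarrow> S = T"
proof -
  define P where "P S T q \<longleftrightarrow>
      (S \<preceq> T \<longleftrightarrow> gen_sum S q \<le> gen_sum T q) \<and> (gen_sum S q = gen_sum T q \<longrightarrow> S = T)" for S T q
  have P: "\<forall>\<^sub>F q in at_left 1. P S T q" if "S \<subseteq> {..<N}" "T \<subseteq> {..<N}" for S T
  proof (cases "S = T")
    case True
    then show ?thesis by (simp add: P_def germ_le_iff_eventually)
  next
    case False
    have "finite S" "finite T" using that finite_subset by blast+
    from germ_trichotomy[OF this False] show ?thesis
    proof
      assume less: "\<forall>\<^sub>F q in at_left 1. gen_sum S q < gen_sum T q"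
      then have "S \<preceq> T"
        unfolding germ_le_iff_eventually by (rule eventually_mono) simp
      with less show ?thesis
        by (auto simp: P_def elim!: eventually_mono)
    next
      assume less: "\<forall>\<^sub>F q in at_left 1. gen_sum T q < gen_sum S q"
      have "\<not> S \<preceq> T"
      proof
        assume "S \<preceq> T"
        then have "\<forall>\<^sub>F q in at_left 1. gen_sum S q \<le> gen_sum T q"
          by (simp add: germ_le_iff_eventually)
        with less have "\<forall>\<^sub>F q in at_left (1::real). False"
          by eventually_elim simp
        then show False by simp
      qed
      with less show ?thesis
        by (auto simp: P_def elim!: eventually_mono)
    qed
  qed
  have "\<forall>\<^sub>F q in at_left 1. \<forall>S\<in>Pow {..<N}. \<forall>T\<in>Pow {..<N}. P S T q"
    using P by (intro eventually_ball_finite ballI) auto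
  moreover have "\<forall>\<^sub>F q in at_left 1. q \<in> {0<..<1::real}"
    by (intro eventually_at_leftI) auto
  ultimately have "\<forall>\<^sub>F q in at_left 1. (0 < q \<and> q < 1) \<and>
      (\<forall>S\<in>Pow {..<N}. \<forall>T\<in>Pow {..<N}. P S T q)"
    by eventually_elim auto
  then obtain q where "0 < q" "q < 1" "\<forall>S\<in>Pow {..<N}. \<forall>T\<in>Pow {..<N}. P S T q"
    using eventually_happens'[OF trivial_limit_at_left_real] by blast
  then show ?thesis
    by (intro that[of q]) (auto simp: P_def)
qed

lemma gen_sum_gap:
  obtains c where "c > 0"
    "\<And>S T. S \<subseteq> {..<N} \<Longrightarrow> T \<subseteq> {..<N} \<Longrightarrow> gen_sum S q < gen_sum T q \<Longrightarrow>
      c \<le> gen_sum T q - gen_sum S q"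
proof -
  define gaps where "gaps = insert 1 {x \<in> (\<lambda>(S, T). gen_sum T q - gen_sum S q) `
      (Pow {..<N} \<times> Pow {..<N}). 0 < x}"
  have fin: "finite gaps" and ne: "gaps \<noteq> {}"
    by (auto simp: gaps_def)
  have "Min gaps > 0"
    using Min_in[OF fin ne] by (auto simp: gaps_def)
  moreover have "Min gaps \<le> gen_sum T q - gen_sum S q"
    if "S \<subseteq> {..<N}" "T \<subseteq> {..<N}" "gen_sum S q < gen_sum T q" for S T
    by (rule Min_le[OF fin]) (use that in \<open>force simp: gaps_def\<close>)
  ultimately show ?thesis by (rule that)
qed

section \<open>Windows and optimal fillings\<close>

lemma ones_subset: "ones u \<subseteq> {..<length u}"
  by (auto simp: ones_def)

lemma ones_eq_iff:
  assumes "length u = length v"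
  shows "ones u = ones v \<longleftrightarrow> u = v"
proof
  assume "ones u = ones v"
  then have "u ! n = v ! n" if "n < length u" for n
    using that assms unfolding ones_def set_eq_iff by (metis mem_Collect_eq)
  then show "u = v"
    using assms by (simp add: list_eq_iff_nth_eq)
qed simp

lemma sones_shift: "sones (u @- s) = ones u \<union> (+) (length u) ` sones s"
proof (intro set_eqI)
  fix n
  show "n \<in> sones (u @- s) \<longleftrightarrow> n \<in> ones u \<union> (+) (length u) ` sones s"
    by (cases "n < length u") (auto simp: sones_def ones_def image_iff le_iff_add not_less)
qed

lemma gen_sum_shift:
  assumes "0 < q" "q < 1"
  shows "gen_sum (sones (u @- s)) q = gen_sum (ones u) q + q ^ length u * gen_sum (sones s) q"
  unfolding sones_shift by (rule gen_sum_concat[OF assms ones_subset])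

lemma avoiding_window:
  assumes "avoiding D (sones (X @- U @- Z))"
  shows "avoiding D (ones U)"
  unfolding avoiding_def
proof (intro ballI impI)
  fix x y assume "x \<in> ones U" "y \<in> ones U" "x < y"
  then have "length X + x \<in> sones (X @- U @- Z)" "length X + y \<in> sones (X @- U @- Z)"
    by (auto simp: sones_def ones_def)
  with assms \<open>x < y\<close> show "y - x \<notin> D"
    unfolding avoiding_def by fastforce
qed

text \<open>Two positions at a distance in \<open>D\<close> are at most \<open>Max D\<close> apart.  So if one of them lies
  outside the window, both lie outside the filling, where the string is unchanged.\<close>

lemma avoiding_replace_filling:
  assumes "finite D" and A: "length A = Max D" and B: "length B = Max D"
    and len: "length Y = length G"
    and old: "avoiding D (sones (X @- (A @ Y @ B) @- Z))"
    and new: "avoiding D (ones (A @ G @ B))"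
  shows "avoiding D (sones (X @- (A @ G @ B) @- Z))"
  unfolding avoiding_def
proof (intro ballI impI notI)
  let ?w = "X @- (A @ Y @ B) @- Z" and ?w' = "X @- (A @ G @ B) @- Z"
  let ?m = "length X" and ?M = "Max D" and ?l = "length G"
  have outside: "?w' !! n = ?w !! n" if "n < ?m + ?M \<or> ?m + ?M + ?l \<le> n" for n
    using that A B len by (auto simp: shift_snth)
  have inside: "?w' !! n = (A @ G @ B) ! (n - ?m)" if "?m \<le> n" "n < ?m + 2 * ?M + ?l" for n
  proof -
    have "n - ?m < length (A @ G @ B)"
      using that A B by simp
    then show ?thesis
      using that(1) by (simp only: shift_snth_ge shift_snth_less)
  qed
  fix x y
  assume x: "x \<in> sones ?w'" and y: "y \<in> sones ?w'" and "x < y" and d: "y - x \<in> D"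
  have close: "y - x \<le> ?M"
    using d \<open>finite D\<close> by simp
  show False
  proof (cases "?m \<le> x \<and> y < ?m + 2 * ?M + ?l")
    case True
    then have "x - ?m \<in> ones (A @ G @ B)" "y - ?m \<in> ones (A @ G @ B)"
      using x y \<open>x < y\<close> A B inside[of x] inside[of y] by (auto simp: sones_def ones_def)
    moreover have "x - ?m < y - ?m" "(y - ?m) - (x - ?m) = y - x"
      using True \<open>x < y\<close> by auto
    ultimately show False
      using new d unfolding avoiding_def by metis
  next
    case False
    then have "(x < ?m + ?M \<or> ?m + ?M + ?l \<le> x) \<and> (y < ?m + ?M \<or> ?m + ?M + ?l \<le> y)"
      using close \<open>x < y\<close> by linarith
    then have "x \<in> sones ?w" "y \<in> sones ?w"
      using x y outside by (auto simp: sones_def)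
    then show False
      using old d \<open>x < y\<close> unfolding avoiding_def by blast
  qed
qed

text \<open>Maximise the value at a point \<open>q\<close> that decides the germ order.  One admissible filling is
  assumed, because along a rewriting sequence the filling about to be replaced is one.\<close>

lemma Gam_greatest:
  assumes Y: "length Y = l" "avoiding D (ones (A @ Y @ B))"
  shows "length (Gam D l A B) = l" (is ?len)
    and "avoiding D (ones (A @ Gam D l A B @ B))" (is ?av)
    and "\<And>Z. length Z = l \<Longrightarrow> avoiding D (ones (A @ Z @ B)) \<Longrightarrow>
      ones (A @ Z @ B) \<preceq> ones (A @ Gam D l A B @ B)"
proof -
  define adm where "adm = {Z. length Z = l \<and> avoiding D (ones (A @ Z @ B))}"
  define N where "N = length A + l + length B"
  define val where "val q Z = gen_sum (ones (A @ Z @ B)) q" for q Z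
  obtain q where
    le: "\<And>S T. S \<subseteq> {..<N} \<Longrightarrow> T \<subseteq> {..<N} \<Longrightarrow> S \<preceq> T \<longleftrightarrow> gen_sum S q \<le> gen_sum T q" and
    eq: "\<And>S T. S \<subseteq> {..<N} \<Longrightarrow> T \<subseteq> {..<N} \<Longrightarrow> gen_sum S q = gen_sum T q \<Longrightarrow> S = T"
    using germ_le_decided_at_point[of N] by metis
  have sub: "ones (A @ Z @ B) \<subseteq> {..<N}" if "Z \<in> adm" for Z
    using ones_subset[of "A @ Z @ B"] that by (simp add: adm_def N_def add.assoc)
  have fin: "finite adm"
    by (rule finite_subset[OF _ finite_lists_length_eq[of UNIV l]]) (auto simp: adm_def)
  have "Y \<in> adm"
    using Y by (simp add: adm_def)
  then obtain G where "G \<in> adm" "Max (val q ` adm) = val q G"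
    using obtains_MAX[OF fin, of "val q"] by blast
  then have G: "G \<in> adm" "\<And>Z. Z \<in> adm \<Longrightarrow> val q Z \<le> val q G"
    using Max_ge[of "val q ` adm"] fin by auto
  let ?greatest = "\<lambda>G. length G = l \<and> avoiding D (ones (A @ G @ B)) \<and>
      (\<forall>Z. length Z = l \<and> avoiding D (ones (A @ Z @ B)) \<longrightarrow>
        ones (A @ Z @ B) \<preceq> ones (A @ G @ B))"
  have "?greatest (Gam D l A B)"
    unfolding Gam_def
  proof (rule theI)
    show "?greatest G"
      using G le sub by (auto simp: adm_def val_def)
  next
    fix H assume H: "?greatest H"
    then have "H \<in> adm" by (simp add: adm_def)
    have "ones (A @ G @ B) \<preceq> ones (A @ H @ B)"
      using H G(1) by (simp add: adm_def)
    then have "val q G \<le> val q H"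
      using le sub \<open>H \<in> adm\<close> G(1) by (simp add: val_def)
    then have "val q G = val q H"
      using G(2)[OF \<open>H \<in> adm\<close>] by simp
    then have "ones (A @ G @ B) = ones (A @ H @ B)"
      using eq sub \<open>H \<in> adm\<close> G(1) by (simp add: val_def)
    then show "H = G"
      using H G(1) by (subst (asm) ones_eq_iff) (auto simp: adm_def)
  qed
  then show ?len ?av "\<And>Z. length Z = l \<Longrightarrow> avoiding D (ones (A @ Z @ B)) \<Longrightarrow>
      ones (A @ Z @ B) \<preceq> ones (A @ Gam D l A B @ B)"
    by blast+
qed

section \<open>Potential growth and convergence\<close>

text \<open>The string rises by \<open>q ^ length X\<close> times the gain of the window, and a window can only
  alter positions \<open>t \<ge> length X\<close>, for which \<open>q ^ t \<le> q ^ length X\<close>.  Avoidance must be carried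
  along: it makes the old filling admissible, hence comparable with the optimal one.\<close>

lemma step_raises_value:
  assumes "finite D"
  obtains q c where "0 < q" "q < 1" "0 < c"
    "\<And>w w'. step D l w w' \<Longrightarrow> avoiding D (sones w) \<Longrightarrow>
      avoiding D (sones w') \<and> gen_sum (sones w) q \<le> gen_sum (sones w') q \<and>
      (\<forall>t. w !! t \<noteq> w' !! t \<longrightarrow> gen_sum (sones w) q + c * q ^ t \<le> gen_sum (sones w') q)"
proof -
  \<comment> \<open>the common length of all windows \<open>A Y B\<close>; both \<open>q\<close> and \<open>c\<close> depend on nothing else\<close>
  define N where "N = 2 * Max D + l"
  obtain q where q: "0 < q" "q < 1" and
    le: "\<And>S T. S \<subseteq> {..<N} \<Longrightarrow> T \<subseteq> {..<N} \<Longrightarrow> S \<preceq> T \<longleftrightarrow> gen_sum S q \<le> gen_sum T q" and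
    eq: "\<And>S T. S \<subseteq> {..<N} \<Longrightarrow> T \<subseteq> {..<N} \<Longrightarrow> gen_sum S q = gen_sum T q \<Longrightarrow> S = T"
    using germ_le_decided_at_point[of N] by metis
  obtain c where c: "c > 0" "\<And>S T. S \<subseteq> {..<N} \<Longrightarrow> T \<subseteq> {..<N} \<Longrightarrow>
      gen_sum S q < gen_sum T q \<Longrightarrow> c \<le> gen_sum T q - gen_sum S q"
    using gen_sum_gap[of N q] by metis
  have "avoiding D (sones w') \<and> gen_sum (sones w) q \<le> gen_sum (sones w') q \<and>
      (\<forall>t. w !! t \<noteq> w' !! t \<longrightarrow> gen_sum (sones w) q + c * q ^ t \<le> gen_sum (sones w') q)"
    if step: "step D l w w'" and av: "avoiding D (sones w)" for w w'
  proof (intro conjI allI impI)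
    obtain A B where at: "step_at D l A B w w'"
      using step unfolding step_def by blast
    then have A: "length A = Max D" and B: "length B = Max D"
      unfolding step_at_def by blast+
    obtain X Y Z where Y: "length Y = l"
      and "w = X @- A @- Y @- B @- Z" "w' = X @- A @- Gam D l A B @- B @- Z"
      using at unfolding step_at_def by (elim conjE exE) (rule that)
    then have w: "w = X @- (A @ Y @ B) @- Z" and w': "w' = X @- (A @ Gam D l A B @ B) @- Z"
      by (simp_all only: shift_append)
    define G where "G = Gam D l A B"
    define U where "U = A @ Y @ B"
    define V where "V = A @ G @ B"
    have avU: "avoiding D (ones U)"
      using avoiding_window av unfolding w U_def by blast
    note Gam = Gam_greatest[OF Y avU[unfolded U_def], folded G_def]
    have len: "length U = N" "length V = N"
      using A B Y Gam(1) by (auto simp: U_def V_def N_def)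
    have sub: "ones U \<subseteq> {..<N}" "ones V \<subseteq> {..<N}"
      using ones_subset[of U] ones_subset[of V] by (simp_all add: len)
    have UV: "gen_sum (ones U) q \<le> gen_sum (ones V) q"
      using Gam(3)[OF Y] avU le[OF sub] by (simp add: U_def V_def)
    have diff: "gen_sum (sones w') q - gen_sum (sones w) q
        = q ^ length X * (gen_sum (ones V) q - gen_sum (ones U) q)"
      unfolding w w' G_def[symmetric] U_def[symmetric] V_def[symmetric]
      by (simp only: gen_sum_shift[OF q] len) (simp add: algebra_simps)
    have "length Y = length G"
      unfolding Y Gam(1) by (rule refl)
    then have "avoiding D (sones (X @- (A @ G @ B) @- Z))"
      by (rule avoiding_replace_filling[OF \<open>finite D\<close> A B _ av[unfolded w] Gam(2)])
    then show "avoiding D (sones w')"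
      by (simp only: w' G_def)
    have "0 \<le> gen_sum (sones w') q - gen_sum (sones w) q"
      unfolding diff using UV q by simp
    then show "gen_sum (sones w) q \<le> gen_sum (sones w') q" by simp
    fix t assume t: "w !! t \<noteq> w' !! t"
    have "length X \<le> t"
      using t unfolding w w' by (metis not_le shift_snth_less)
    have "U \<noteq> V"
      using t unfolding w w' G_def[symmetric] U_def[symmetric] V_def[symmetric] by blast
    then have "ones U \<noteq> ones V"
      using len by (simp add: ones_eq_iff)
    then have "gen_sum (ones U) q < gen_sum (ones V) q"
      using UV eq[OF sub] by fastforce
    then have gap: "c \<le> gen_sum (ones V) q - gen_sum (ones U) q"
      using c(2) sub by blast
    have "q ^ t \<le> q ^ length X"
      using q \<open>length X \<le> t\<close> by (intro power_decreasing) auto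
    then have "q ^ t * c \<le> q ^ length X * (gen_sum (ones V) q - gen_sum (ones U) q)"
      using gap c(1) q by (intro mult_mono) auto
    then show "gen_sum (sones w) q + c * q ^ t \<le> gen_sum (sones w') q"
      unfolding diff[symmetric] by (simp add: algebra_simps)
  qed
  with q c(1) show ?thesis by (rule that)
qed

lemma eventually_constant_if_Suc_eq:
  fixes f :: "nat \<Rightarrow> 'a"
  assumes "\<forall>\<^sub>F k in sequentially. f (Suc k) = f k"
  shows "\<exists>a. \<forall>\<^sub>F k in sequentially. a = f k"
proof -
  obtain K where K: "\<And>k. k \<ge> K \<Longrightarrow> f (Suc k) = f k"
    using assms unfolding eventually_sequentially by blast
  have "f k = f K" if "k \<ge> K" for k
    using that by (induction k rule: dec_induct) (auto simp: K)
  then show ?thesis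
    unfolding eventually_sequentially by metis
qed

theorem theorem13:
  fixes D :: "nat set" and l :: nat and w :: "nat \<Rightarrow> bool stream"
  assumes "finite D" and "D \<noteq> {}" and "\<forall>d\<in>D. 0 < d"
    and "Max D \<le> l"
    and "avoiding D (sones (w 0))"
    and "\<forall>k. step D l (w k) (w (Suc k))"
  shows "\<exists>wstar :: bool stream. \<forall>t. \<forall>\<^sub>F k in sequentially. wstar !! t = w k !! t"
proof -
  obtain q c where q: "0 < q" "q < 1" and "0 < c" and gain:
    "\<And>w w'. step D l w w' \<Longrightarrow> avoiding D (sones w) \<Longrightarrow>
      avoiding D (sones w') \<and> gen_sum (sones w) q \<le> gen_sum (sones w') q \<and>
      (\<forall>t. w !! t \<noteq> w' !! t \<longrightarrow> gen_sum (sones w) q + c * q ^ t \<le> gen_sum (sones w') q)"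
    by (rule step_raises_value[OF \<open>finite D\<close>]) blast
  have av: "avoiding D (sones (w k))" for k
  proof (induction k)
    case 0
    show ?case by fact
  next
    case (Suc k)
    then show ?case using gain assms(6) by blast
  qed
  note gain = gain[OF assms(6)[rule_format] av]
  define v where "v k = gen_sum (sones (w k)) q" for k
  have "incseq v"
    unfolding v_def using gain by (intro incseq_SucI) blast
  then obtain L where L: "v \<longlonglongrightarrow> L"
    using incseq_convergent[of v "1 / (1 - q)"] gen_sum_le_geometric[OF q] unfolding v_def by blast
  have diff: "(\<lambda>k. v (Suc k) - v k) \<longlonglongrightarrow> 0"
    using tendsto_diff[OF LIMSEQ_Suc[OF L] L] by simp
  have "\<exists>b. \<forall>\<^sub>F k in sequentially. b = w k !! t" for t
  proof (rule eventually_constant_if_Suc_eq)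
    have "\<forall>\<^sub>F k in sequentially. v (Suc k) - v k < c * q ^ t"
      using order_tendstoD(2)[OF diff] \<open>0 < c\<close> q by simp
    then show "\<forall>\<^sub>F k in sequentially. w (Suc k) !! t = w k !! t"
    proof (rule eventually_mono)
      fix k assume small: "v (Suc k) - v k < c * q ^ t"
      have "v k + c * q ^ t \<le> v (Suc k)" if "w k !! t \<noteq> w (Suc k) !! t"
        unfolding v_def using gain that by blast
      with small show "w (Suc k) !! t = w k !! t"
        by fastforce
    qed
  qed
  then obtain b where b: "\<And>t. \<forall>\<^sub>F k in sequentially. b t = w k !! t"
    by metis
  show ?thesis
    using b by (intro exI[of _ "smap b nats"]) simp
qed

end
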